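(* The following coefficients (assumed finite) can be used to construct the corresponding valid inequalities. (1) Let $\hat\rho$ be the optimal value of $$\max\ d_\ell^\top y-d_\ell^\top y'$$ over $z,z'\in\{0,1\}^{n_x}$, $y,y'\in Y$, $\gamma\in\mathbb{R}^{n_x}$ subject to $\mathbf 1^\top z+\mathbf 1^\top z'-2\cdot\mathbf 1^\top\gamma=1$, $0\le\gamma\le z$, $z+z'-\mathbf 1\le\gamma\le z'$, $B_\ell y\le h_\ell-A_\ell z$, $B_\ell y'\le h_\ell-A_\ell z'$. Then $\hat\rho$ is sufficiently large for the penalty-based inequality: $\phi(x)=L_p(x,\rho)$ for all $x\in\{0,1\}^{n_x}$ and $\rho\ge\hat\rho$, and hence for each $z\in\{0,1\}^{n_x}$ the inequality $d_\ell^\top y\ge\phi(z)-\hat\rho(\mathbf 1^\top x+\mathbf 1^\top z-2x^\top z)$ is valid and tight for $d_\ell^\top y\ge\phi(x)$. (2) For all $i\in[n_x]$ let $L_i$ and $U_i$ be, respectively, the minimum and the maximum of $d_\ell^\top y-d_\ell^\top y'$ over $z,z'\in\{0,1\}^{n_x}$, $y,y'\in Y$ subject to $z_{-i}=z'_{-i}$, $z_i=0$, $z'_i=1$, $B_\ell y\le h_\ell-A_\ell z$, $B_\ell y'\le h_\ell-A_\ell z'$. Then $U$ and $L$ are sufficiently large and sufficiently small, respectively, for the Lagrangian-based inequality: $\phi(x)=L_\ell(x,\lambda)$ for all $x\in\{0,1\}^{n_x}$ and all $\lambda$ with $\lambda_i\ge U_i$ if $x_i=1$ and $\lambda_i\le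 L_i$ if $x_i=0$, and hence for each $z\in\{0,1\}^{n_x}$ the inequality $d_\ell^\top y\ge\phi(z)-\hat\lambda(z)^\top(x-z)$ is valid and tight for $d_\ell^\top y\ge\phi(x)$.
   Context: $\phi:\{0,1\}^{n_x}\to\mathbb{R}$ is the (real-valued) value function $\phi(x)=\max\{d_\ell^\top y' : y'\in Y,\ B_\ell y'\le h_\ell-A_\ell x\}$, where $Y\subseteq\mathbb{R}^{n_y}$ and $d_\ell,A_\ell,B_\ell,h_\ell$ are real data of compatible dimensions. $\psi:[0,1]^{n_x}\to\mathbb{R}$ is the extension of $\phi$ that is affine in each individual coordinate, $\psi(z)=\sum_{x\in\{0,1\}^{n_x}}\phi(x)\prod_{i:x_i=1}z_i\prod_{i:x_i=0}(1-z_i)$. $\mathbf 1$ is the all-ones vector, $\odot$ the entrywise product, $[n]=\{1,\dots,n\}$, $z_{-i}$ is $z$ with entry $i$ removed, and vector inequalities are entrywise. $\hat\lambda(z):=U\odot(\mathbf 1-z)+L\odot z$. $L_p(x,\rho)=\max_{z\in[0,1]^{n_x}}\psi(z)-\rho(\mathbf 1^\top x+\mathbf 1^\top z-2x^\top z)$ for $\rho\ge0$; $L_\ell(x,\lambda)=\max_{z\in[0,1]^{n_x}}\psi(z)-\lambda^\top(x-z)$ for $\lambda\in\mathbb{R}^{n_x}$. An inequality $d_\ell^\top y\ge r(x)$ is "valid and tight" for $d_\ell^\top y\ge\phi(x)$ if $r(x)\le\phi(x)$ for all $x\in\{0,1\}^{n_x}$ with equality for some $x\in\{0,1\}^{n_x}$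 (for the inequalities above, at $x=z$). *)

theory Defs
  imports "HOL-Analysis.Analysis"
begin

text \<open>
  On \<^typ>\<open>real ^ 'n\<close> the library order \<open>\<le>\<close> and product \<open>*\<close> are entrywise, \<open>1\<close> is the all-ones
  vector, \<open>{0..1}\<close> is the unit box and \<open>\<bullet>\<close> is the Euclidean inner product.
\<close>

definition binary_vecs :: "(real ^ 'n) set" where
  "binary_vecs = {x. \<forall>i. x $ i = 0 \<or> x $ i = 1}"

text \<open>
  \<open>maximum f S\<close> is meaningful only if the maximum is attained; it is unspecified otherwise.
\<close>

definition maximum :: "('a \<Rightarrow> real) \<Rightarrow> 'a set \<Rightarrow> real" where
  "maximum f S = (GREATEST v. v \<in> f ` S)"

definition attains_max :: "('a \<Rightarrow> real) \<Rightarrow> 'a set \<Rightarrow> bool" where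
  "attains_max f S \<longleftrightarrow> (\<exists>s. is_arg_max f (\<lambda>t. t \<in> S) s)"

definition feasible ::
  "(real ^ 'q) set \<Rightarrow> real ^ 'p ^ 'm \<Rightarrow> real ^ 'q ^ 'm \<Rightarrow> real ^ 'm \<Rightarrow> real ^ 'p \<Rightarrow> (real ^ 'q) set" where
  "feasible Y A B h x = {y \<in> Y. B *v y \<le> h - A *v x}"

definition value_fun ::
  "(real ^ 'q) set \<Rightarrow> real ^ 'q \<Rightarrow> real ^ 'p ^ 'm \<Rightarrow> real ^ 'q ^ 'm \<Rightarrow> real ^ 'm \<Rightarrow> real ^ 'p \<Rightarrow> real" where
  "value_fun Y d A B h x = maximum (\<lambda>y'. d \<bullet> y') (feasible Y A B h x)"

definition multiaffine :: "(real ^ 'n \<Rightarrow> real) \<Rightarrow> real ^ 'n \<Rightarrow> real" where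
  "multiaffine \<phi> z =
     (\<Sum>x\<in>binary_vecs. \<phi> x * (\<Prod>i\<in>{i. x $ i = 1}. z $ i) * (\<Prod>i\<in>{i. x $ i = 0}. 1 - z $ i))"

definition penalty :: "real ^ 'n \<Rightarrow> real ^ 'n \<Rightarrow> real" where
  "penalty x z = 1 \<bullet> x + 1 \<bullet> z - 2 * (x \<bullet> z)"

definition L_p :: "(real ^ 'n \<Rightarrow> real) \<Rightarrow> real ^ 'n \<Rightarrow> real \<Rightarrow> real" where
  "L_p \<phi> x \<rho> = maximum (\<lambda>z. multiaffine \<phi> z - \<rho> * penalty x z) {0..1}"

definition L_l :: "(real ^ 'n \<Rightarrow> real) \<Rightarrow> real ^ 'n \<Rightarrow> real ^ 'n \<Rightarrow> real" where
  "L_l \<phi> x \<mu> = maximum (\<lambda>z. multiaffine \<phi> z - \<mu> \<bullet> (x - z)) {0..1}"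

text \<open>
  The optimal values defining the coefficients are suprema and infima in the extended reals, so
  that finiteness is an explicit hypothesis and attainment is not required.
\<close>

definition rho_hat ::
  "(real ^ 'q) set \<Rightarrow> real ^ 'q \<Rightarrow> real ^ 'p ^ 'm \<Rightarrow> real ^ 'q ^ 'm \<Rightarrow> real ^ 'm \<Rightarrow> ereal" where
  "rho_hat Y d A B h = Sup {ereal (d \<bullet> y - d \<bullet> y') | z z' y y' \<gamma>.
     z \<in> binary_vecs \<and> z' \<in> binary_vecs \<and> y \<in> Y \<and> y' \<in> Y \<and>
     1 \<bullet> z + 1 \<bullet> z' - 2 * (1 \<bullet> \<gamma>) = 1 \<and>
     0 \<le> \<gamma> \<and> \<gamma> \<le> z \<and> z + z' - 1 \<le> \<gamma> \<and> \<gamma> \<le> z' \<and>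
     B *v y \<le> h - A *v z \<and> B *v y' \<le> h - A *v z'}"

definition flip_differences ::
  "(real ^ 'q) set \<Rightarrow> real ^ 'q \<Rightarrow> real ^ 'p ^ 'm \<Rightarrow> real ^ 'q ^ 'm \<Rightarrow> real ^ 'm \<Rightarrow> 'p \<Rightarrow> ereal set" where
  "flip_differences Y d A B h i = {ereal (d \<bullet> y - d \<bullet> y') | z z' y y'.
     z \<in> binary_vecs \<and> z' \<in> binary_vecs \<and> y \<in> Y \<and> y' \<in> Y \<and>
     (\<forall>j. j \<noteq> i \<longrightarrow> z $ j = z' $ j) \<and> z $ i = 0 \<and> z' $ i = 1 \<and>
     B *v y \<le> h - A *v z \<and> B *v y' \<le> h - A *v z'}"

definition lower_coeff ::
  "(real ^ 'q) set \<Rightarrow> real ^ 'q \<Rightarrow> real ^ 'p ^ 'm \<Rightarrow> real ^ 'q ^ 'm \<Rightarrow> real ^ 'm \<Rightarrow> 'p \<Rightarrow> ereal" where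
  "lower_coeff Y d A B h i = Inf (flip_differences Y d A B h i)"

definition upper_coeff ::
  "(real ^ 'q) set \<Rightarrow> real ^ 'q \<Rightarrow> real ^ 'p ^ 'm \<Rightarrow> real ^ 'q ^ 'm \<Rightarrow> real ^ 'm \<Rightarrow> 'p \<Rightarrow> ereal" where
  "upper_coeff Y d A B h i = Sup (flip_differences Y d A B h i)"

definition lambda_hat :: "real ^ 'n \<Rightarrow> real ^ 'n \<Rightarrow> real ^ 'n \<Rightarrow> real ^ 'n" where
  "lambda_hat L U z = U * (1 - z) + L * z"

definition penalty_rhs :: "(real ^ 'n \<Rightarrow> real) \<Rightarrow> real \<Rightarrow> real ^ 'n \<Rightarrow> real ^ 'n \<Rightarrow> real" where
  "penalty_rhs \<phi> \<rho> z x = \<phi> z - \<rho> * penalty x z"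

definition lagrangian_rhs ::
  "(real ^ 'n \<Rightarrow> real) \<Rightarrow> real ^ 'n \<Rightarrow> real ^ 'n \<Rightarrow> real ^ 'n \<Rightarrow> real ^ 'n \<Rightarrow> real" where
  "lagrangian_rhs \<phi> L U z x = \<phi> z - lambda_hat L U z \<bullet> (x - z)"

text \<open>
  \<open>valid_and_tight \<phi> r\<close>: the inequality \<open>d \<bullet> y \<ge> r x\<close> is valid and tight for \<open>d \<bullet> y \<ge> \<phi> x\<close>.
\<close>

definition valid_and_tight :: "(real ^ 'n \<Rightarrow> real) \<Rightarrow> (real ^ 'n \<Rightarrow> real) \<Rightarrow> bool" where
  "valid_and_tight \<phi> r \<longleftrightarrow> (\<forall>x\<in>binary_vecs. r x \<le> \<phi> x) \<and> (\<exists>x\<in>binary_vecs. r x = \<phi> x)"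

text \<open>
  Sanity checks: the sum in \<^const>\<open>multiaffine\<close> is finite, and the maxima in \<^const>\<open>L_p\<close> and
  \<^const>\<open>L_l\<close> are always attained.
\<close>

lemma finite_binary_vecs: "finite (binary_vecs :: (real ^ 'n) set)"
proof -
  have "(binary_vecs :: (real ^ 'n) set) \<subseteq> range (\<lambda>S. \<chi> i. if i \<in> S then 1 else 0)"
  proof
    fix x :: "real ^ 'n"
    assume "x \<in> binary_vecs"
    then have "x = (\<chi> i. if i \<in> {i. x $ i = 1} then 1 else 0)"
      by (auto simp: binary_vecs_def vec_eq_iff)
    then show "x \<in> range (\<lambda>S. \<chi> i. if i \<in> S then 1 else 0)"
      by blast
  qed
  then show ?thesis
    by (rule finite_subset) simp
qed

lemma maximum_eqI:
  assumes "s \<in> S" and "\<And>t. t \<in> S \<Longrightarrow> f t \<le> f s"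
  shows "maximum f S = f s"
  unfolding maximum_def using assms by (intro Greatest_equality) auto

lemma attains_max_unit_box:
  fixes f :: "real ^ 'n \<Rightarrow> real"
  assumes "continuous_on {0..1} f"
  shows "attains_max f {0..1}"
proof -
  have "compact {0..1 :: real ^ 'n}"
    by (simp add: interval_cbox compact_cbox)
  moreover have "(0 :: real ^ 'n) \<in> {0..1}"
    by (simp add: less_eq_vec_def)
  ultimately obtain s where "s \<in> {0..1}" "\<forall>t\<in>{0..1}. f t \<le> f s"
    using continuous_attains_sup[of "{0..1}" f] assms by blast
  then show ?thesis
    unfolding attains_max_def is_arg_max_def by (metis not_le)
qed

lemma continuous_on_multiaffine: "continuous_on S (multiaffine \<phi>)"
  unfolding multiaffine_def by (intro continuous_intros)

lemma L_p_attained: "attains_max (\<lambda>z. multiaffine \<phi> z - \<rho> * penalty x z) {0..1}"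
  unfolding penalty_def
  by (intro attains_max_unit_box continuous_intros continuous_on_multiaffine)

lemma L_l_attained: "attains_max (\<lambda>z. multiaffine \<phi> z - \<mu> \<bullet> (x - z)) {0..1}"
  by (intro attains_max_unit_box continuous_intros continuous_on_multiaffine)

end

theory Submission
  imports Defs
begin

text \<open>
  The multiaffine extension at \<open>z\<close> is the expectation of \<open>\<phi>\<close> under the product distribution on
  the binary vectors with mean \<open>z\<close>, so an affine majorant of \<open>\<phi>\<close> on the binary vectors is a
  majorant of the extension on the whole box.  Such a majorant, exact at \<open>x\<close>, comes from walking
  from any binary vector to \<open>x\<close> one coordinate at a time, each step being controlled by a
  coefficient.  The penalty function is the Lagrangian one with multiplier \<open>\<rho> (2 x - 1)\<close>.
\<close>

section \<open>Vertex weights and the multiaffine extension\<close>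

definition vertex_weight :: "real ^ 'n \<Rightarrow> real ^ 'n \<Rightarrow> real" where
  "vertex_weight z x = (\<Prod>i\<in>{i. x $ i = 1}. z $ i) * (\<Prod>i\<in>{i. x $ i = 0}. 1 - z $ i)"

lemma multiaffine_vertex_weight:
  "multiaffine \<phi> z = (\<Sum>x\<in>binary_vecs. \<phi> x * vertex_weight z x)"
  by (simp add: multiaffine_def vertex_weight_def mult.assoc)

lemma vertex_weight_nonneg: "z \<in> {0..1} \<Longrightarrow> 0 \<le> vertex_weight z x"
  unfolding vertex_weight_def
  by (intro mult_nonneg_nonneg prod_nonneg) (auto simp: less_eq_vec_def)

lemma binary_vecs_subset_unit_box: "binary_vecs \<subseteq> {0..1 :: real ^ 'n}"
proof
  fix x :: "real ^ 'n"
  assume "x \<in> binary_vecs"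
  then have "0 \<le> x $ i \<and> x $ i \<le> 1" for i
    by (cases "x $ i = 0") (auto simp: binary_vecs_def dest: spec[of _ i])
  then show "x \<in> {0..1}"
    by (simp add: less_eq_vec_def)
qed

text \<open>Expanding the product picks \<open>f i\<close> or \<open>g i\<close> in each coordinate,
  and a binary vector records the choice. Leaving \<open>f\<close> and \<open>g\<close> free lets
  one identity give both the total mass and the mean of the weights.\<close>

lemma sum_binary_vecs_prod:
  fixes f g :: "'n::finite \<Rightarrow> real"
  shows "(\<Sum>x\<in>(binary_vecs :: (real ^ 'n) set).
           (\<Prod>i\<in>{i. x $ i = 1}. f i) * (\<Prod>i\<in>{i. x $ i = 0}. g i)) = (\<Prod>i\<in>UNIV. f i + g i)"
proof -
  define v :: "'n set \<Rightarrow> real ^ 'n" where "v S = (\<chi> i. if i \<in> S then 1 else 0)" for S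
  have "(\<Prod>i\<in>UNIV. f i + g i) = (\<Sum>S\<in>Pow UNIV. prod f S * prod g (UNIV - S))"
    by (rule prod_add) simp
  also have "\<dots> = (\<Sum>x\<in>(binary_vecs :: (real ^ 'n) set).
      (\<Prod>i\<in>{i. x $ i = 1}. f i) * (\<Prod>i\<in>{i. x $ i = 0}. g i))"
  proof (rule sum.reindex_bij_witness[where i = "\<lambda>x. {i. x $ i = 1}" and j = v])
    fix S assume "S \<in> Pow (UNIV :: 'n set)"
    show "{i. v S $ i = 1} = S"
      by (simp add: v_def)
    show "v S \<in> binary_vecs"
      by (simp add: v_def binary_vecs_def)
    show "(\<Prod>i\<in>{i. v S $ i = 1}. f i) * (\<Prod>i\<in>{i. v S $ i = 0}. g i) = prod f S * prod g (UNIV - S)"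
      by (auto simp: v_def intro!: arg_cong2[of _ _ _ _ "(*)"] prod.cong)
  next
    fix x :: "real ^ 'n"
    assume "x \<in> binary_vecs"
    then show "v {i. x $ i = 1} = x"
      by (auto simp: v_def binary_vecs_def vec_eq_iff)
  qed simp
  finally show ?thesis by simp
qed

lemma sum_vertex_weight: "(\<Sum>x\<in>binary_vecs. vertex_weight z x) = 1"
  unfolding vertex_weight_def by (subst sum_binary_vecs_prod) simp

lemma sum_vertex_weight_component:
  fixes z :: "real ^ 'n"
  shows "(\<Sum>x\<in>binary_vecs. vertex_weight z x * x $ k) = z $ k"
proof -
  \<comment> \<open>The factor \<open>x $ k\<close> discards the vertices with
    \<open>x $ k = 0\<close>. Zeroing the factor \<open>1 - z $ k\<close> has the same effect and
    keeps the product form that can be summed.\<close>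
  have "vertex_weight z x * x $ k =
      (\<Prod>i\<in>{i. x $ i = 1}. z $ i) * (\<Prod>i\<in>{i. x $ i = 0}. if i = k then 0 else 1 - z $ i)"
    if "x \<in> binary_vecs" for x
  proof (cases "x $ k = 0")
    case True
    then have "(\<Prod>i\<in>{i. x $ i = 0}. if i = k then 0 else 1 - z $ i) = 0"
      by (intro prod_zero) auto
    then show ?thesis
      using True by simp
  next
    case False
    then have "(\<Prod>i\<in>{i. x $ i = 0}. if i = k then 0 else 1 - z $ i) = (\<Prod>i\<in>{i. x $ i = 0}. 1 - z $ i)"
      by (intro prod.cong) auto
    moreover have "x $ k = 1"
      using False that by (auto simp: binary_vecs_def)
    ultimately show ?thesis
      by (simp add: vertex_weight_def)
  qed
  then have "(\<Sum>x\<in>binary_vecs. vertex_weight z x * x $ k) =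
      (\<Prod>i\<in>UNIV. z $ i + (if i = k then 0 else 1 - z $ i))"
    using sum_binary_vecs_prod[of "\<lambda>i. z $ i" "\<lambda>i. if i = k then 0 else 1 - z $ i"] by simp
  also have "\<dots> = (\<Prod>i\<in>UNIV. if i = k then z $ i else 1)"
    by (intro prod.cong) auto
  finally show ?thesis by simp
qed

lemma sum_vertex_weight_inner:
  "(\<Sum>x\<in>binary_vecs. vertex_weight z x * (a \<bullet> x)) = a \<bullet> z"
proof -
  have "(\<Sum>x\<in>binary_vecs. vertex_weight z x * (a \<bullet> x)) =
      (\<Sum>k\<in>UNIV. a $ k * (\<Sum>x\<in>binary_vecs. vertex_weight z x * x $ k))"
    unfolding inner_vec_def inner_real_def sum_distrib_left
    by (subst sum.swap) (simp add: mult_ac)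
  then show ?thesis
    by (simp add: sum_vertex_weight_component inner_vec_def)
qed

text \<open>At a vertex the distribution is a point mass, because a coordinate in which
  \<open>x\<close> and \<open>z\<close> differ contributes a zero factor. Hence the extension agrees
  with \<open>\<phi>\<close> on binary vectors.\<close>

lemma vertex_weight_binary:
  assumes "z \<in> binary_vecs" "x \<in> binary_vecs"
  shows "vertex_weight z x = (if x = z then 1 else 0)"
proof (cases "x = z")
  case True
  then show ?thesis by (simp add: vertex_weight_def)
next
  case False
  then obtain k where "x $ k \<noteq> z $ k"
    by (auto simp: vec_eq_iff)
  then consider "x $ k = 1" "z $ k = 0" | "x $ k = 0" "z $ k = 1"
    using assms unfolding binary_vecs_def by (metis (mono_tags, lifting) mem_Collect_eq)
  then have "vertex_weight z x = 0"
    by cases (auto simp: vertex_weight_def)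
  then show ?thesis
    using False by simp
qed

lemma multiaffine_binary: "z \<in> binary_vecs \<Longrightarrow> multiaffine \<phi> z = \<phi> z"
  by (simp add: multiaffine_vertex_weight vertex_weight_binary finite_binary_vecs
      if_distrib[of "(*) _"] sum.delta cong: if_cong)

text \<open>Averaging the bound over the vertices: nonnegative weights preserve it, total mass 1
  keeps \<open>c\<close>, and mean \<open>z\<close> turns \<open>a \<bullet> u\<close> into
  \<open>a \<bullet> z\<close>.\<close>

lemma multiaffine_le_affine:
  assumes le: "\<And>u. u \<in> binary_vecs \<Longrightarrow> \<phi> u \<le> c + a \<bullet> u" and z: "z \<in> {0..1}"
  shows "multiaffine \<phi> z \<le> c + a \<bullet> z"
proof -
  have "multiaffine \<phi> z \<le> (\<Sum>u\<in>binary_vecs. (c + a \<bullet> u) * vertex_weight z u)"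
    unfolding multiaffine_vertex_weight
    by (intro sum_mono mult_right_mono le vertex_weight_nonneg z)
  also have "\<dots> = c * (\<Sum>u\<in>binary_vecs. vertex_weight z u)
      + (\<Sum>u\<in>binary_vecs. vertex_weight z u * (a \<bullet> u))"
    by (simp add: ring_distribs sum.distrib sum_distrib_left mult.commute)
  finally show ?thesis
    by (simp add: sum_vertex_weight sum_vertex_weight_inner)
qed

section \<open>Walks on the cube and the Lagrangian maximum\<close>

definition steps_bounded :: "(real ^ 'n \<Rightarrow> real) \<Rightarrow> real ^ 'n \<Rightarrow> real ^ 'n \<Rightarrow> bool" where
  "steps_bounded \<phi> x \<mu> \<longleftrightarrow> (\<forall>u\<in>binary_vecs. \<forall>v\<in>binary_vecs. \<forall>i.
     (\<forall>j. j \<noteq> i \<longrightarrow> u $ j = v $ j) \<and> u $ i \<noteq> v $ i \<and> v $ i = x $ i \<longrightarrow>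
     \<phi> u - \<phi> v \<le> \<mu> $ i * (v $ i - u $ i))"

text \<open>Induction on the Hamming distance from \<open>u\<close> to \<open>x\<close>. The walk
  only ever corrects a coordinate that disagrees with \<open>x\<close>, so it suffices that
  \<open>steps_bounded\<close> controls steps whose endpoint \<open>v\<close> agrees with
  \<open>x\<close> at \<open>i\<close>.\<close>

lemma steps_bounded_binary:
  fixes x :: "real ^ 'n"
  assumes steps: "steps_bounded \<phi> x \<mu>" and x: "x \<in> binary_vecs" and u: "u \<in> binary_vecs"
  shows "\<phi> u \<le> \<phi> x + \<mu> \<bullet> (x - u)"
  using u
proof (induction "card {i. u $ i \<noteq> x $ i}" arbitrary: u)
  case 0
  then have "u = x" by (auto simp: vec_eq_iff)
  then show ?case by simp
next
  case (Suc n)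
  then have "{i. u $ i \<noteq> x $ i} \<noteq> {}" by force
  then obtain i where i: "u $ i \<noteq> x $ i" by blast
  define v where "v = (\<chi> j. if j = i then x $ i else u $ j)"
  have v: "v \<in> binary_vecs"
    using x Suc.prems by (auto simp: v_def binary_vecs_def)
  have "{j. v $ j \<noteq> x $ j} = {j. u $ j \<noteq> x $ j} - {i}"
    by (auto simp: v_def)
  then have "card {j. v $ j \<noteq> x $ j} = n"
    using Suc.hyps(2) i by simp
  then have "\<phi> v \<le> \<phi> x + \<mu> \<bullet> (x - v)"
    using Suc.hyps(1)[OF _ v] by simp
  moreover have "\<phi> u - \<phi> v \<le> \<mu> $ i * (v $ i - u $ i)"
    using steps Suc.prems v i unfolding steps_bounded_def by (simp add: v_def)
  \<comment> \<open>The step bound is therefore the increment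
    \<open>\<mu> \<bullet> (v - u)\<close>, which adds to \<open>\<mu> \<bullet> (x - v)\<close> to
    give \<open>\<mu> \<bullet> (x - u)\<close>.\<close>
  moreover have "v - u = axis i (v $ i - u $ i)"
    by (auto simp: v_def vec_eq_iff axis_def)
  then have "\<mu> \<bullet> (v - u) = \<mu> $ i * (v $ i - u $ i)"
    by (simp add: inner_axis)
  ultimately show ?case
    by (simp add: inner_diff_right)
qed

text \<open>The walk bound is affine in its starting point, so it extends from the vertices to the
  box and caps the objective at \<open>\<phi> x\<close>. The point \<open>z = x\<close> attains this
  cap.\<close>

lemma L_l_eq:
  assumes steps: "steps_bounded \<phi> x \<mu>" and x: "x \<in> binary_vecs"
  shows "L_l \<phi> x \<mu> = \<phi> x"
proof -
  have "multiaffine \<phi> z - \<mu> \<bullet> (x - z) \<le> \<phi> x" if "z \<in> {0..1}" for z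
    using multiaffine_le_affine[of \<phi> "\<phi> x + \<mu> \<bullet> x" "- \<mu>" z] that
      steps_bounded_binary[OF steps x]
    by (simp add: inner_diff_right add_diff_eq diff_add_eq)
  then have "L_l \<phi> x \<mu> = multiaffine \<phi> x - \<mu> \<bullet> (x - x)"
    unfolding L_l_def using x binary_vecs_subset_unit_box
    by (intro maximum_eqI) (auto simp: multiaffine_binary)
  then show ?thesis
    using x by (simp add: multiaffine_binary)
qed

text \<open>Only \<open>x\<close> has to be binary, through
  \<open>x \<bullet> x = 1 \<bullet> x\<close>. Since \<open>z\<close> is arbitrary, the penalty and
  Lagrangian objectives coincide on the whole box.\<close>

lemma penalty_eq_inner:
  assumes "x \<in> binary_vecs"
  shows "\<rho> * penalty x z = (\<rho> *\<^sub>R (2 *\<^sub>R x - 1)) \<bullet> (x - z)"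
proof -
  have "x \<bullet> x = 1 \<bullet> x"
    using assms by (auto simp: inner_vec_def binary_vecs_def intro!: sum.cong)
  then show ?thesis
    by (simp add: penalty_def inner_diff_left inner_diff_right algebra_simps)
qed

lemma L_p_eq_L_l:
  "x \<in> binary_vecs \<Longrightarrow> L_p \<phi> x \<rho> = L_l \<phi> x (\<rho> *\<^sub>R (2 *\<^sub>R x - 1))"
  by (simp only: L_p_def L_l_def penalty_eq_inner)

section \<open>Differences of the value function and the coefficients\<close>

lemma value_fun_attained:
  assumes "attains_max (\<lambda>y. d \<bullet> y) (feasible Y A B h x)"
  obtains y where "y \<in> Y" "B *v y \<le> h - A *v x" "d \<bullet> y = value_fun Y d A B h x"
proof -
  obtain y where y: "is_arg_max (\<lambda>y. d \<bullet> y) (\<lambda>t. t \<in> feasible Y A B h x) y"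
    using assms unfolding attains_max_def by blast
  then have "value_fun Y d A B h x = d \<bullet> y"
    unfolding value_fun_def is_arg_max_def by (intro maximum_eqI) (auto simp: not_less)
  with y that show ?thesis
    unfolding is_arg_max_def feasible_def by auto
qed

text \<open>Optimal solutions at \<open>u\<close> and \<open>v\<close> together form a feasible
  point with this objective value. Membership serves both the infimum \<open>lower_coeff\<close> and
  the supremum \<open>upper_coeff\<close>.\<close>

lemma value_fun_diff_flip_differences:
  assumes "attains_max (\<lambda>y. d \<bullet> y) (feasible Y A B h u)"
    and "attains_max (\<lambda>y. d \<bullet> y) (feasible Y A B h v)"
    and "u \<in> binary_vecs" "v \<in> binary_vecs"
    and "\<forall>j. j \<noteq> i \<longrightarrow> u $ j = v $ j" "u $ i = 0" "v $ i = 1"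
  shows "ereal (value_fun Y d A B h u - value_fun Y d A B h v) \<in> flip_differences Y d A B h i"
proof -
  obtain y where y: "y \<in> Y" "B *v y \<le> h - A *v u" "d \<bullet> y = value_fun Y d A B h u"
    using assms(1) by (rule value_fun_attained)
  obtain y' where y': "y' \<in> Y" "B *v y' \<le> h - A *v v" "d \<bullet> y' = value_fun Y d A B h v"
    using assms(2) by (rule value_fun_attained)
  show ?thesis
    unfolding flip_differences_def y(3)[symmetric] y'(3)[symmetric]
    using assms(3-) y(1,2) y'(1,2)
    by (intro CollectI exI[of _ u] exI[of _ v] exI[of _ y] exI[of _ y']) simp
qed

lemma value_fun_diff_le_rho_hat:
  assumes "attains_max (\<lambda>y. d \<bullet> y) (feasible Y A B h u)"
    and "attains_max (\<lambda>y. d \<bullet> y) (feasible Y A B h v)"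
    and u: "u \<in> binary_vecs" and v: "v \<in> binary_vecs"
    and "\<forall>j. j \<noteq> i \<longrightarrow> u $ j = v $ j" "u $ i \<noteq> v $ i"
  shows "ereal (value_fun Y d A B h u - value_fun Y d A B h v) \<le> rho_hat Y d A B h"
proof -
  obtain y where y: "y \<in> Y" "B *v y \<le> h - A *v u" "d \<bullet> y = value_fun Y d A B h u"
    using assms(1) by (rule value_fun_attained)
  obtain y' where y': "y' \<in> Y" "B *v y' \<le> h - A *v v" "d \<bullet> y' = value_fun Y d A B h v"
    using assms(2) by (rule value_fun_attained)
  have b: "u $ j = 0 \<and> v $ j = 0 \<or> u $ j = 0 \<and> v $ j = 1 \<or> u $ j = 1 \<and> v $ j = 0 \<or> u $ j = 1 \<and> v $ j = 1" for j
    using u v by (auto simp: binary_vecs_def)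
  \<comment> \<open>The constraints on \<open>\<gamma>\<close> are the McCormick inequalities for a
    product of binaries, so the entrywise product \<open>u * v\<close> is a witness.\<close>
  have "0 \<le> u $ j * v $ j \<and> u $ j * v $ j \<le> u $ j \<and> u $ j + v $ j - 1 \<le> u $ j * v $ j
      \<and> u $ j * v $ j \<le> v $ j" for j
    using b[of j] by (elim disjE) simp_all
  then have "0 \<le> u * v" "u * v \<le> u" "u + v - 1 \<le> u * v" "u * v \<le> v"
    by (simp_all add: less_eq_vec_def)
  \<comment> \<open>With this witness the left side is the Hamming distance: a coordinate
    contributes 1 if \<open>u\<close> and \<open>v\<close> differ there and 0 otherwise. Only
    \<open>i\<close> differs.\<close>
  moreover have "1 \<bullet> u + 1 \<bullet> v - 2 * (1 \<bullet> (u * v)) = 1"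
  proof -
    have "1 \<bullet> u + 1 \<bullet> v - 2 * (1 \<bullet> (u * v)) = (\<Sum>j\<in>UNIV. u $ j + v $ j - 2 * (u $ j * v $ j))"
      by (simp add: inner_vec_def sum.distrib sum_subtractf sum_distrib_left)
    also have "\<dots> = (\<Sum>j\<in>UNIV. if j = i then 1 else 0)"
    proof (intro sum.cong refl)
      fix j
      show "u $ j + v $ j - 2 * (u $ j * v $ j) = (if j = i then 1 else 0)"
        using b[of j] assms(5,6) by (elim disjE) auto
    qed
    finally show ?thesis by simp
  qed
  ultimately show ?thesis
    unfolding rho_hat_def y(3)[symmetric] y'(3)[symmetric] using u v y(1,2) y'(1,2)
    by (intro Sup_upper CollectI exI[of _ u] exI[of _ v] exI[of _ y] exI[of _ y'] exI[of _ "u * v"]) simp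
qed

section \<open>From coefficient bounds to exact maxima and tight inequalities\<close>

theorem proposition5:
  fixes Y :: "(real ^ 'q) set" and d :: "real ^ 'q"
    and A :: "real ^ 'p ^ 'm" and B :: "real ^ 'q ^ 'm" and h :: "real ^ 'm"
    and \<phi> :: "real ^ 'p \<Rightarrow> real"
  defines "\<phi> \<equiv> value_fun Y d A B h"
  assumes real_valued: "\<And>x. x \<in> binary_vecs \<Longrightarrow> attains_max (\<lambda>y'. d \<bullet> y') (feasible Y A B h x)"
  shows "(\<forall>\<rho>h :: real. ereal \<rho>h = rho_hat Y d A B h \<longrightarrow>
            (\<forall>x\<in>binary_vecs. \<forall>\<rho>\<ge>\<rho>h. \<phi> x = L_p \<phi> x \<rho>) \<and>
            (\<forall>z\<in>binary_vecs. valid_and_tight \<phi> (penalty_rhs \<phi> \<rho>h z) \<and> penalty_rhs \<phi> \<rho>h z z = \<phi> z))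
       \<and> (\<forall>L U :: real ^ 'p.
            (\<forall>i. ereal (L $ i) = lower_coeff Y d A B h i \<and> ereal (U $ i) = upper_coeff Y d A B h i) \<longrightarrow>
            (\<forall>x\<in>binary_vecs. \<forall>\<mu>. (\<forall>i. (x $ i = 1 \<longrightarrow> U $ i \<le> \<mu> $ i) \<and> (x $ i = 0 \<longrightarrow> \<mu> $ i \<le> L $ i)) \<longrightarrow>
               \<phi> x = L_l \<phi> x \<mu>) \<and>
            (\<forall>z\<in>binary_vecs. valid_and_tight \<phi> (lagrangian_rhs \<phi> L U z) \<and> lagrangian_rhs \<phi> L U z z = \<phi> z))"
proof (intro conjI allI impI)
  fix \<rho>h :: real
  assume \<rho>h: "ereal \<rho>h = rho_hat Y d A B h"
  have steps: "steps_bounded \<phi> x (\<rho> *\<^sub>R (2 *\<^sub>R x - 1))" if "x \<in> binary_vecs" "\<rho>h \<le> \<rho>" for x \<rho>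
    unfolding steps_bounded_def
  proof (intro ballI allI impI, elim conjE)
    fix u v :: "real ^ 'p" and i
    assume uv: "u \<in> binary_vecs" "v \<in> binary_vecs" "\<forall>j. j \<noteq> i \<longrightarrow> u $ j = v $ j"
      "u $ i \<noteq> v $ i" "v $ i = x $ i"
    have "ereal (\<phi> u - \<phi> v) \<le> ereal \<rho>h"
      unfolding \<rho>h \<phi>_def using uv real_valued by (intro value_fun_diff_le_rho_hat) auto
    \<comment> \<open>Both factors are 1 if \<open>x $ i = 1\<close> and -1 if
      \<open>x $ i = 0\<close>, so the step bound is just \<open>\<rho>\<close>.\<close>
    moreover have "(2 * x $ i - 1) * (v $ i - u $ i) = 1"
      using uv by (auto simp: binary_vecs_def dest!: spec[of _ i])
    ultimately show "\<phi> u - \<phi> v \<le> (\<rho> *\<^sub>R (2 *\<^sub>R x - 1)) $ i * (v $ i - u $ i)"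
      using that by (simp add: mult.assoc)
  qed
  show "\<forall>x\<in>binary_vecs. \<forall>\<rho>\<ge>\<rho>h. \<phi> x = L_p \<phi> x \<rho>"
    by (simp add: L_p_eq_L_l L_l_eq steps)
  have tight: "penalty_rhs \<phi> \<rho>h z z = \<phi> z" if "z \<in> binary_vecs" for z
    using that by (simp add: penalty_rhs_def penalty_eq_inner)
  \<comment> \<open>Validity at \<open>x\<close> comes from the walk from \<open>z\<close> to
    \<open>x\<close>, so the multiplier is built from the evaluation point \<open>x\<close> and not
    from \<open>z\<close>.\<close>
  have "penalty_rhs \<phi> \<rho>h z x \<le> \<phi> x" if "z \<in> binary_vecs" "x \<in> binary_vecs" for z x
  proof -
    have "penalty z x = penalty x z"
      by (simp add: penalty_def inner_commute)
    then show ?thesis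
      using steps_bounded_binary[OF steps[OF that(2) order_refl] that(2,1)] that
      by (simp add: penalty_rhs_def penalty_eq_inner)
  qed
  with tight show "\<forall>z\<in>binary_vecs. valid_and_tight \<phi> (penalty_rhs \<phi> \<rho>h z) \<and> penalty_rhs \<phi> \<rho>h z z = \<phi> z"
    unfolding valid_and_tight_def by blast
next
  fix L U :: "real ^ 'p"
  assume LU: "\<forall>i. ereal (L $ i) = lower_coeff Y d A B h i \<and> ereal (U $ i) = upper_coeff Y d A B h i"
  have bounds: "L $ i \<le> \<phi> u - \<phi> v" "\<phi> u - \<phi> v \<le> U $ i"
    if uv: "u \<in> binary_vecs" "v \<in> binary_vecs" "\<forall>j. j \<noteq> i \<longrightarrow> u $ j = v $ j" "u $ i = 0" "v $ i = 1"
    for u v i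
  proof -
    have *: "ereal (\<phi> u - \<phi> v) \<in> flip_differences Y d A B h i"
      unfolding \<phi>_def using uv real_valued by (intro value_fun_diff_flip_differences) auto
    have "ereal (L $ i) \<le> ereal (\<phi> u - \<phi> v)"
      using LU Inf_lower[OF *] by (simp add: lower_coeff_def)
    then show "L $ i \<le> \<phi> u - \<phi> v" by simp
    have "ereal (\<phi> u - \<phi> v) \<le> ereal (U $ i)"
      using LU Sup_upper[OF *] by (simp add: upper_coeff_def)
    then show "\<phi> u - \<phi> v \<le> U $ i" by simp
  qed
  have steps: "steps_bounded \<phi> x \<mu>"
    if \<mu>: "\<forall>i. (x $ i = 1 \<longrightarrow> U $ i \<le> \<mu> $ i) \<and> (x $ i = 0 \<longrightarrow> \<mu> $ i \<le> L $ i)" for x \<mu>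
    unfolding steps_bounded_def
  proof (intro ballI allI impI, elim conjE)
    fix u v :: "real ^ 'p" and i
    assume uv: "u \<in> binary_vecs" "v \<in> binary_vecs" "\<forall>j. j \<noteq> i \<longrightarrow> u $ j = v $ j"
      "u $ i \<noteq> v $ i" "v $ i = x $ i"
    then consider "u $ i = 0" "v $ i = 1" | "u $ i = 1" "v $ i = 0"
      by (auto simp: binary_vecs_def dest!: spec[of _ i])
    then show "\<phi> u - \<phi> v \<le> \<mu> $ i * (v $ i - u $ i)"
    proof cases
      case 1
      then show ?thesis
        using bounds(2)[of u v i] uv \<mu>[rule_format, of i] by simp
    next
      \<comment> \<open>In \<open>flip_differences\<close> the vector with entry 0 comes first, so
        \<open>u\<close> and \<open>v\<close> swap roles. Since \<open>v $ i - u $ i = -1\<close>,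
        the lower bound \<open>L $ i\<close> is the relevant one.\<close>
      case 2
      then show ?thesis
        using bounds(1)[of v u i] uv \<mu>[rule_format, of i] by simp
    qed
  qed
  then show "\<forall>x\<in>binary_vecs. \<forall>\<mu>. (\<forall>i. (x $ i = 1 \<longrightarrow> U $ i \<le> \<mu> $ i) \<and> (x $ i = 0 \<longrightarrow> \<mu> $ i \<le> L $ i)) \<longrightarrow>
      \<phi> x = L_l \<phi> x \<mu>"
    by (simp add: L_l_eq)
  have tight: "lagrangian_rhs \<phi> L U z z = \<phi> z" for z
    by (simp add: lagrangian_rhs_def)
  have "lagrangian_rhs \<phi> L U z x \<le> \<phi> x" if "z \<in> binary_vecs" "x \<in> binary_vecs" for z x
  proof -
    \<comment> \<open>This is the extreme admissible multiplier at \<open>x\<close>, whereas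
      \<open>lambda_hat L U z\<close> is built from \<open>z\<close>. Where \<open>x\<close> and
      \<open>z\<close> differ, both equal \<open>U $ i\<close> (if \<open>x $ i = 1\<close>) or
      \<open>L $ i\<close> (if \<open>x $ i = 0\<close>); elsewhere \<open>x - z\<close>
      vanishes.\<close>
    define \<mu> where "\<mu> = U * x + L * (1 - x)"
    have "steps_bounded \<phi> x \<mu>"
      by (rule steps) (simp add: \<mu>_def)
    moreover have "lambda_hat L U z \<bullet> (x - z) = \<mu> \<bullet> (x - z)"
      unfolding inner_vec_def
    proof (intro sum.cong refl)
      fix i
      show "lambda_hat L U z $ i \<bullet> (x - z) $ i = \<mu> $ i \<bullet> (x - z) $ i"
        using that by (auto simp: binary_vecs_def \<mu>_def lambda_hat_def dest!: spec[of _ i])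
    qed
    ultimately show ?thesis
      using steps_bounded_binary[of \<phi> x \<mu> z] that by (simp add: lagrangian_rhs_def)
  qed
  with tight show "\<forall>z\<in>binary_vecs. valid_and_tight \<phi> (lagrangian_rhs \<phi> L U z) \<and> lagrangian_rhs \<phi> L U z z = \<phi> z"
    unfolding valid_and_tight_def by blast
qed

end
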